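(* Let $K$ be a commutative ring with division by integers, and let $A=(a_{ij})$ be an $n\times n$ matrix over $K$. Then $$\det(A)=\frac{1}{n!}\sum_{\sigma\in S_n}(-1)^{\tau(\sigma)}\Big\{(-1)^n\gamma_\sigma^n+\sum_{k=1}^n\Big((-1)^{n-k}\sum_{1\le j_1<\cdots<j_k\le n}\Big(\gamma_\sigma+\sum_{s=1}^k a_{j_s\sigma(j_s)}\Big)^n\Big)\Big\},$$ where $\{\gamma_\sigma\}_{\sigma\in S_n}$ is a set of $n!$ free variables $\gamma_\sigma\in K$. In particular, for all $\gamma_\sigma=\gamma$, $$\det(A)=\frac{(-1)^{n-1}}{n!}\Big\{\sum_{l\in L_{n-1}^{(e)}}(\gamma+su(l))^n-\sum_{l\in L_{n-1}^{(o)}}(\gamma+su(l))^n+\sum_{l\in L_n^{(o)}}(\gamma+su(l))^n-\sum_{l\in L_n^{(e)}}(\gamma+su(l))^n\Big\},$$ and, for all $\gamma_\sigma=0$, $$\det(A)=\frac{(-1)^{n-1}}{n!}\Big\{\sum_{l\in L_{n-1}^{(e)}}su(l)^n-\sum_{l\in L_{n-1}^{(o)}}su(l)^n+\sum_{l\in L_n^{(o)}}su(l)^n-\sum_{l\in L_n^{(e)}}su(l)^n\Big\}.$$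
   Context: A ring is "with division by integers" if for every nonzero integer $m$ the map $x\mapsto mx$ is bijective on the ring; $\frac1m x$ denotes the inverse image of $x$. $S_n$ is the set of permutations of $\{1,\dots,n\}$, $\tau(\sigma)$ is the number of inversions of $\sigma$, and $S_n^{(e)}$, $S_n^{(o)}$ are the sets of even and odd permutations. The determinant is $\det(A)=\sum_{\sigma\in S_n}(-1)^{\tau(\sigma)}a_{1\sigma(1)}\cdots a_{n\sigma(n)}$. For $\sigma\in S_n$ and $1\le i_1<\dots<i_k\le n$, the sequence $l=(a_{i_1\sigma(i_1)},\dots,a_{i_k\sigma(i_k)})$ is a subdiagonal of length $k$ of the diagonal $(a_{1\sigma(1)},\dots,a_{n\sigma(n)})$; subdiagonals are identified by their positions $\{(i_1,\sigma(i_1)),\dots,(i_k,\sigma(i_k))\}$ in the matrix. $L_k^{(e)}$ (respectively $L_k^{(o)}$) is the set of all subdiagonals of length $k$ of diagonals with $\sigma\in S_n^{(e)}$ (respectively $\sigma\in S_n^{(o)}$). $su(l)=\sum_{s=1}^k a_{i_s\sigma(i_s)}$ is the sum of the elements of $l$. For $n=1$, $L_0^{(e)}$ consists of the empty subdiagonal, with $su=0$, and $L_0^{(o)}=\emptyset$.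
   Formalization: In the second and third formulas the prefactor (-1)^{n-1}/n! is corrected to -1/n!; the printed sign agrees for even n but yields -det(A) for odd n (e.g. n=1, A=(a) gives -a). *)

theory Defs
  imports "Jordan_Normal_Form.Determinant"
begin

text \<open>Indices run over \<open>{0..<n}\<close> instead of \<open>{1..n}\<close>, as in the library's
  matrices and determinant.\<close>

definition division_by_integers :: "'a::ring_1 itself \<Rightarrow> bool" where
  "division_by_integers _ \<longleftrightarrow> (\<forall>m::int. m \<noteq> 0 \<longrightarrow> bij (\<lambda>x::'a. of_int m * x))"

text \<open>\<open>int_quot m x\<close> is \<open>(1/m) x\<close>; it is meaningful only if multiplication by \<open>m\<close> is bijective.\<close>

definition int_quot :: "int \<Rightarrow> 'a::ring_1 \<Rightarrow> 'a" where
  "int_quot m x = inv_into UNIV (\<lambda>y. of_int m * y) x"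

definition perms :: "nat \<Rightarrow> (nat \<Rightarrow> nat) set" where
  "perms n = {\<sigma>. \<sigma> permutes {0..<n}}"

definition even_perms :: "nat \<Rightarrow> (nat \<Rightarrow> nat) set" where
  "even_perms n = {\<sigma> \<in> perms n. evenperm \<sigma>}"

definition odd_perms :: "nat \<Rightarrow> (nat \<Rightarrow> nat) set" where
  "odd_perms n = {\<sigma> \<in> perms n. \<not> evenperm \<sigma>}"

definition inversions :: "nat \<Rightarrow> (nat \<Rightarrow> nat) \<Rightarrow> nat" where
  "inversions n \<sigma> = card {(i, j). i < j \<and> j < n \<and> \<sigma> j < \<sigma> i}"

text \<open>A subdiagonal is represented by its set of positions. A set of positions arising from
  several permutations in \<open>S\<close> therefore counts once.\<close>

definition subdiagonals :: "nat \<Rightarrow> (nat \<Rightarrow> nat) set \<Rightarrow> nat \<Rightarrow> (nat \<times> nat) set set" where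
  "subdiagonals n S k =
     {(\<lambda>i. (i, \<sigma> i)) ` I | \<sigma> I. \<sigma> \<in> S \<and> I \<subseteq> {0..<n} \<and> card I = k}"

definition L_even :: "nat \<Rightarrow> nat \<Rightarrow> (nat \<times> nat) set set" where
  "L_even n k = subdiagonals n (even_perms n) k"

definition L_odd :: "nat \<Rightarrow> nat \<Rightarrow> (nat \<times> nat) set set" where
  "L_odd n k = subdiagonals n (odd_perms n) k"

definition su :: "'a::comm_monoid_add mat \<Rightarrow> (nat \<times> nat) set \<Rightarrow> 'a" where
  "su A l = (\<Sum>p\<in>l. A $$ p)"

text \<open>Sign convention. In the formulas that sum over subdiagonals of lengths \<open>n - 1\<close> and \<open>n\<close>,
  the factor in front of the braces has to be \<open>-1\<close>. The source prints \<open>(-1)^(n-1)\<close>, which is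
  the same for even \<open>n\<close> but gives \<open>- det A\<close> for odd \<open>n\<close>: already for \<open>n = 1\<close> and
  \<open>A = (a)\<close> the braces contain \<open>\<gamma> - (\<gamma> + a) = - a\<close>.\<close>

end

theory Submission
  imports Defs
begin

text \<open>For a fixed \<open>\<sigma>\<close> the braces are an \<open>n\<close>-th finite difference of \<open>x\<^sup>n\<close> with steps
  \<open>a_(i \<sigma>(i))\<close>, hence equal \<open>n!\<close> times the product of the steps, whatever \<open>\<gamma>_\<sigma>\<close> is.
  When all \<open>\<gamma>_\<sigma>\<close> coincide, the sums over positions \<open>J\<close> with \<open>card J \<le> n - 2\<close> cancel between
  even and odd permutations, because composing with a transposition of two indices outside \<open>J\<close>
  changes the parity but not the subdiagonal. For \<open>card J \<ge> n - 1\<close> a subdiagonal determines its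
  permutation, so the remaining sums are sums over sets of subdiagonals.\<close>

section \<open>Integer quotients and finite differences of powers\<close>

lemma int_quot_mult:
  fixes x :: "'a::ring_1"
  assumes "division_by_integers TYPE('a)" and "m \<noteq> 0"
  shows "int_quot m (of_int m * x) = x"
  using assms unfolding division_by_integers_def int_quot_def
  by (metis bij_is_inj inv_f_f)

text \<open>Induction on \<open>S\<close>: one step \<open>x a\<close> turns a power of degree
  \<open>m\<close> into a polynomial of lower degree, and the remaining \<open>card S\<close>
  differences annihilate all its terms except that of degree \<open>card S\<close>. The powers below
  the top one are included because the induction needs them.\<close>

lemma finite_difference_power:
  fixes x :: "'b \<Rightarrow> 'a::comm_ring_1"
  assumes "finite S" and "m \<le> card S"
  shows "(\<Sum>J\<in>Pow S. (-1) ^ card (S - J) * (c + sum x J) ^ m) =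
    (if m = card S then of_nat (fact m) * prod x S else 0)"
  using assms
proof (induction S arbitrary: m rule: finite_induct)
  case empty
  then show ?case by simp
next
  case (insert a S)
  let ?s = "\<lambda>J. (-1) ^ card (S - J) :: 'a"
  let ?y = "\<lambda>J. c + sum x J"
  let ?D = "\<lambda>i. \<Sum>J\<in>Pow S. ?s J * ?y J ^ i"
  let ?t = "\<lambda>J. (-1) ^ card (insert a S - J) * ?y J ^ m"
  have inj: "inj_on (Set.insert a) (Pow S)"
    using insert.hyps(2) by (auto simp: inj_on_def)
  have out: "?t J = - (?s J * ?y J ^ m)" if "J \<in> Pow S" for J
  proof -
    have "insert a S - J = insert a (S - J)" using that insert.hyps by auto
    then show ?thesis using insert.hyps by simp
  qed
  have ins: "?t (insert a J) = ?s J * (?y J + x a) ^ m" if "J \<in> Pow S" for J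
  proof -
    have "insert a S - insert a J = S - J" using insert.hyps by auto
    moreover have "finite J" "a \<notin> J" using that insert.hyps finite_subset by auto
    ultimately show ?thesis by (simp add: algebra_simps)
  qed
  \<comment> \<open>The binomial term of degree \<open>m\<close> in \<open>y\<close> cancels, so the
    exponent drops.\<close>
  have diff: "(y + x a) ^ m - y ^ m = (\<Sum>i<m. of_nat (m choose i) * y ^ i * x a ^ (m - i))" for y
    unfolding binomial_ring[of y "x a" m] by (simp add: lessThan_Suc_atMost[symmetric])
  have "(\<Sum>J\<in>Pow (insert a S). ?t J) = (\<Sum>J\<in>Pow S. ?t J) + (\<Sum>J\<in>Pow S. ?t (insert a J))"
    unfolding Pow_insert
    by (subst sum.union_disjoint) (use insert.hyps inj in \<open>auto simp: sum.reindex\<close>)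
  also have "\<dots> = (\<Sum>J\<in>Pow S. ?s J * ((?y J + x a) ^ m - ?y J ^ m))"
    using out ins by (simp add: sum_negf sum_subtractf right_diff_distrib)
  also have "\<dots> = (\<Sum>J\<in>Pow S. \<Sum>i<m. of_nat (m choose i) * x a ^ (m - i) * (?s J * ?y J ^ i))"
    unfolding diff by (simp add: sum_distrib_left mult_ac)
  also have "\<dots> = (\<Sum>i<m. of_nat (m choose i) * x a ^ (m - i) * ?D i)"
    by (subst sum.swap) (simp add: sum_distrib_left)
  \<comment> \<open>From \<open>i < m\<close> and \<open>m \<le> Suc (card S)\<close> follows
    \<open>i \<le> card S\<close>, so the induction hypothesis covers every exponent.\<close>
  also have "\<dots> = (\<Sum>i<m. if i = card S then
      of_nat (m choose i) * x a ^ (m - i) * (of_nat (fact i) * prod x S) else 0)"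
    by (rule sum.cong) (use insert in auto)
  also have "\<dots> = (if card S < m then
      of_nat (m choose card S) * x a ^ (m - card S) * (of_nat (fact (card S)) * prod x S) else 0)"
    by (simp add: sum.delta)
  \<comment> \<open>Here \<open>card S < m\<close> forces \<open>m = Suc (card S)\<close>: the
    binomial coefficient is \<open>m\<close> and \<open>x a\<close> has exponent 1.\<close>
  also have "\<dots> = (if m = card (insert a S) then of_nat (fact m) * prod x (insert a S) else 0)"
    using insert.hyps insert.prems by (auto simp: algebra_simps)
  finally show ?case .
qed

section \<open>Inversion count and sign of a permutation\<close>

text \<open>Inversions are attached to unordered pairs, so that a permutation acts on them by taking
  images.\<close>

definition inverted :: "(nat \<Rightarrow> nat) \<Rightarrow> nat set \<Rightarrow> bool" where
  "inverted \<sigma> P \<longleftrightarrow> (\<exists>i j. P = {i, j} \<and> i < j \<and> \<sigma> j < \<sigma> i)"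

lemma inverted_pair: "i < j \<Longrightarrow> inverted \<sigma> {i, j} \<longleftrightarrow> \<sigma> j < \<sigma> i"
  unfolding inverted_def by (auto simp: doubleton_eq_iff)

lemma inverted_comp:
  assumes "inj \<sigma>" "inj \<tau>" "card P = 2"
  shows "inverted (\<sigma> \<circ> \<tau>) P \<longleftrightarrow> inverted \<tau> P \<noteq> inverted \<sigma> (\<tau> ` P)"
proof -
  obtain i j where P: "P = {i, j}" "i < j"
    using assms(3) unfolding card_2_iff by (metis insert_commute nat_neq_iff)
  have ne: "\<tau> i \<noteq> \<tau> j" "\<sigma> (\<tau> i) \<noteq> \<sigma> (\<tau> j)"
    using assms P by (auto dest: injD)
  show ?thesis
  proof (cases "\<tau> i < \<tau> j")
    case True
    then show ?thesis using P by (simp add: inverted_pair)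
  next
    case False
    then have "\<tau> ` P = {\<tau> j, \<tau> i}" "\<tau> j < \<tau> i" using P ne by auto
    then show ?thesis using P ne by (auto simp: inverted_pair)
  qed
qed

definition doubletons :: "nat \<Rightarrow> nat set set" where
  "doubletons n = {P. P \<subseteq> {0..<n} \<and> card P = 2}"

lemma finite_doubletons [simp]: "finite (doubletons n)"
  unfolding doubletons_def by simp

lemma inversions_eq_card_inverted: "inversions n \<sigma> = card {P \<in> doubletons n. inverted \<sigma> P}"
proof -
  let ?f = "\<lambda>(i, j). {i, j :: nat}"
  have "bij_betw ?f {(i, j). i < j \<and> j < n \<and> \<sigma> j < \<sigma> i} {P \<in> doubletons n. inverted \<sigma> P}"
    unfolding bij_betw_def
  proof
    show "inj_on ?f {(i, j). i < j \<and> j < n \<and> \<sigma> j < \<sigma> i}"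
      by (auto simp: inj_on_def doubleton_eq_iff)
    show "?f ` {(i, j). i < j \<and> j < n \<and> \<sigma> j < \<sigma> i} = {P \<in> doubletons n. inverted \<sigma> P}"
      unfolding doubletons_def inverted_def by (auto simp: image_iff)
  qed
  then show ?thesis unfolding inversions_def by (rule bij_betw_same_card)
qed

lemma minus_one_power_inversions_prod:
  "(-1 :: int) ^ inversions n \<sigma> = (\<Prod>P\<in>doubletons n. if inverted \<sigma> P then -1 else 1)"
  unfolding inversions_eq_card_inverted
  by (subst prod.If_cases) (auto simp: Int_def)

lemma bij_betw_image_doubletons:
  assumes "\<tau> permutes {0..<n}"
  shows "bij_betw ((`) \<tau>) (doubletons n) (doubletons n)"
proof -
  have inj: "inj_on ((`) \<tau>) (doubletons n)"
    using permutes_inj[OF assms] by (simp add: inj_on_def inj_image_eq_iff)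
  have "(`) \<tau> ` doubletons n \<subseteq> doubletons n"
    using permutes_image[OF assms] card_image[OF permutes_inj_on[OF assms]]
    unfolding doubletons_def by auto
  then show ?thesis using inj by (simp add: bij_betw_def endo_inj_surj)
qed

text \<open>By \<open>inverted_comp\<close>, the sign of a composite at a pair \<open>P\<close> is
  the sign of \<tau> at \<open>P\<close> times that of \<sigma> at the image of \<open>P\<close>. In
  the product over all pairs, the images again run through all pairs.\<close>

lemma minus_one_power_inversions_comp:
  assumes "\<sigma> permutes {0..<n}" "\<tau> permutes {0..<n}"
  shows "(-1 :: int) ^ inversions n (\<sigma> \<circ> \<tau>) = (-1) ^ inversions n \<sigma> * (-1) ^ inversions n \<tau>"
proof -
  let ?s = "\<lambda>\<sigma> P. if inverted \<sigma> P then -1 else 1 :: int"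
  have inj: "inj \<sigma>" "inj \<tau>" using assms by (auto intro: permutes_inj)
  have "(\<Prod>P\<in>doubletons n. ?s (\<sigma> \<circ> \<tau>) P) = (\<Prod>P\<in>doubletons n. ?s \<sigma> (\<tau> ` P) * ?s \<tau> P)"
    by (rule prod.cong) (auto simp: inverted_comp[OF inj] doubletons_def)
  also have "\<dots> = (\<Prod>P\<in>doubletons n. ?s \<sigma> P) * (\<Prod>P\<in>doubletons n. ?s \<tau> P)"
    unfolding prod.distrib
    using prod.reindex_bij_betw[OF bij_betw_image_doubletons[OF assms(2)], of "?s \<sigma>"] by simp
  finally show ?thesis unfolding minus_one_power_inversions_prod .
qed

text \<open>Besides \<open>(a, b)\<close> itself, each \<open>i\<close> strictly between
  \<open>a\<close> and \<open>b\<close> contributes the two inversions \<open>(a, i)\<close> and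
  \<open>(i, b)\<close>.\<close>

lemma odd_inversions_transpose:
  assumes "a < b" "b < n"
  shows "odd (inversions n (transpose a b))"
proof -
  let ?I = "{a<..<b}"
  have "{(i, j). i < j \<and> j < n \<and> transpose a b j < transpose a b i} =
      insert (a, b) (Pair a ` ?I \<union> (\<lambda>i. (i, b)) ` ?I)"
    using assms by (auto simp: transpose_def split: if_splits)
  moreover have "card (Pair a ` ?I \<union> (\<lambda>i. (i, b)) ` ?I) = card ?I + card ?I"
    by (subst card_Un_disjoint) (auto simp: card_image inj_on_def)
  moreover have "(a, b) \<notin> Pair a ` ?I \<union> (\<lambda>i. (i, b)) ` ?I" by auto
  ultimately show ?thesis unfolding inversions_def by simp
qed

text \<open>Both sides are multiplicative and equal -1 on transpositions, which generate. This links
  the inversion count of the theorem to the sign in the library's determinant.\<close>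

lemma minus_one_power_inversions:
  assumes "\<sigma> permutes {0..<n}"
  shows "(-1) ^ inversions n \<sigma> = sign \<sigma>"
  using assms finite_atLeastLessThan
proof (induction rule: permutes_induct)
  case id
  have "{(i, j). i < j \<and> j < n \<and> id j < id i} = {}" by auto
  then show ?case unfolding inversions_def by (simp only:) simp
next
  case (swap a b p)
  have t: "transpose a b permutes {0..<n}" using swap by (simp add: permutes_swap_id)
  have "odd (inversions n (transpose a b))"
    using swap odd_inversions_transpose[of a b n] odd_inversions_transpose[of b a n]
    by (cases a b rule: linorder_cases) (auto simp: transpose_commute)
  moreover have "permutation p" "permutation (transpose a b)"
    using swap t by (auto intro: permutation_permutes[THEN iffD2])
  ultimately show ?case
    using swap t
    by (simp add: minus_one_power_inversions_comp sign_compose sign_swap_id del: o_apply comp_apply flip: comp_def)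
qed

section \<open>Sums over permutations and over subdiagonals\<close>

lemma finite_perms [simp]: "finite (perms n)"
  unfolding perms_def by (simp add: finite_permutations)

lemma sum_signof:
  fixes f :: "(nat \<Rightarrow> nat) \<Rightarrow> 'a::comm_ring_1"
  shows "(\<Sum>\<sigma>\<in>perms n. signof \<sigma> * f \<sigma>) = sum f (even_perms n) - sum f (odd_perms n)"
proof -
  have "perms n = even_perms n \<union> odd_perms n" "even_perms n \<inter> odd_perms n = {}"
    by (auto simp: even_perms_def odd_perms_def)
  moreover have "finite (even_perms n)" "finite (odd_perms n)"
    by (auto simp: even_perms_def odd_perms_def)
  moreover have "(\<Sum>\<sigma>\<in>even_perms n. signof \<sigma> * f \<sigma>) = sum f (even_perms n)"
    by (rule sum.cong) (auto simp: even_perms_def sign_def)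
  moreover have "(\<Sum>\<sigma>\<in>odd_perms n. signof \<sigma> * f \<sigma>) = - sum f (odd_perms n)"
    unfolding sum_negf[symmetric] by (rule sum.cong) (auto simp: odd_perms_def sign_def)
  ultimately show ?thesis by (simp add: sum.union_disjoint)
qed

text \<open>Right composition with the transposition is an involution that exchanges even and odd
  permutations.\<close>

lemma sum_even_perms_eq_sum_odd_perms:
  assumes "a < n" "b < n" "a \<noteq> b"
    and "\<And>\<sigma>. f (\<sigma> \<circ> transpose a b) = f \<sigma>"
  shows "sum f (even_perms n) = sum f (odd_perms n)"
proof (rule sum.reindex_bij_witness[where
      i = "\<lambda>\<sigma>. \<sigma> \<circ> transpose a b" and j = "\<lambda>\<sigma>. \<sigma> \<circ> transpose a b"])
  have t: "transpose a b permutes {0..<n}" using assms by (simp add: permutes_swap_id)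
  then have pt: "permutation (transpose a b)" using permutation_permutes by blast
  have pp: "permutation \<sigma>" if "\<sigma> permutes {0..<n}" for \<sigma>
    using that permutation_permutes by blast
  show "\<sigma> \<circ> transpose a b \<in> odd_perms n" if "\<sigma> \<in> even_perms n" for \<sigma>
    using that assms t pt pp
    by (auto simp: even_perms_def odd_perms_def perms_def permutes_compose evenperm_comp evenperm_swap)
  show "\<sigma> \<circ> transpose a b \<in> even_perms n" if "\<sigma> \<in> odd_perms n" for \<sigma>
    using that assms t pt pp
    by (auto simp: even_perms_def odd_perms_def perms_def permutes_compose evenperm_comp evenperm_swap)
qed (use assms in \<open>auto simp: comp_assoc\<close>)

lemma permutes_eqI_off_one:
  assumes "p permutes S" "q permutes S" and eq: "\<And>j. j \<in> S \<Longrightarrow> j \<noteq> i \<Longrightarrow> p j = q j"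
  shows "p = q"
proof -
  have *: "p j = q j" if "j \<noteq> i" for j
    using that assms by (cases "j \<in> S") (auto simp: permutes_not_in)
  have "p i = q i"
  proof (rule ccontr)
    assume "p i \<noteq> q i"
    \<comment> \<open>The point where \<open>q\<close> takes the value \<open>p i\<close> is not
      \<open>i\<close>, so \<open>p\<close> would take this value twice.\<close>
    obtain k where k: "q k = p i" using permutes_surj[OF assms(2)] by (metis surjD)
    with \<open>p i \<noteq> q i\<close> have "k \<noteq> i" by auto
    with k * have "p k = p i" by simp
    with \<open>k \<noteq> i\<close> show False using permutes_inj[OF assms(1)] by (auto dest: injD)
  qed
  with * show ?thesis by (intro ext) metis
qed

lemma su_graph: "su A ((\<lambda>i. (i, \<sigma> i)) ` J) = (\<Sum>j\<in>J. A $$ (j, \<sigma> j))"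
  unfolding su_def by (subst sum.reindex) (auto simp: inj_on_def)

text \<open>The positions give back \<open>J\<close> as their first coordinates, and \<sigma>
  because at most one index lies outside \<open>J\<close>. So summing over the set of subdiagonals
  is summing over pairs \<open>(J, \<sigma>)\<close>.\<close>

lemma sum_subdiagonals:
  fixes f :: "(nat \<times> nat) set \<Rightarrow> 'b::comm_monoid_add"
  assumes "S \<subseteq> perms n" "n \<le> Suc k"
  shows "sum f (subdiagonals n S k) =
    (\<Sum>J | J \<subseteq> {0..<n} \<and> card J = k. \<Sum>\<sigma>\<in>S. f ((\<lambda>i. (i, \<sigma> i)) ` J))"
proof -
  let ?g = "\<lambda>(J, \<sigma>). (\<lambda>i. (i, \<sigma> i)) ` J"
  let ?Js = "{J. J \<subseteq> {0..<n} \<and> card J = k}"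
  have inj: "inj_on ?g (?Js \<times> S)"
  proof (rule inj_onI)
    fix p q
    assume p: "p \<in> ?Js \<times> S" and q: "q \<in> ?Js \<times> S" and "?g p = ?g q"
    obtain I \<sigma> J \<tau> where pq: "p = (I, \<sigma>)" "q = (J, \<tau>)" by (metis surj_pair)
    have I: "\<sigma> \<in> S" and J: "J \<subseteq> {0..<n}" "card J = k" "\<tau> \<in> S"
      using p q pq by auto
    have eq: "(\<lambda>i. (i, \<sigma> i)) ` I = (\<lambda>i. (i, \<tau> i)) ` J"
      using \<open>?g p = ?g q\<close> pq by simp
    have "fst ` (\<lambda>i. (i, \<sigma> i)) ` I = fst ` (\<lambda>i. (i, \<tau> i)) ` J" using eq by simp
    then have IJ: "I = J" by (simp add: image_image)
    have agree: "\<sigma> j = \<tau> j" if "j \<in> J" for j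
      using eq that IJ by (auto simp: image_iff set_eq_iff)
    have perm: "\<sigma> permutes {0..<n}" "\<tau> permutes {0..<n}"
      using I J assms(1) by (auto simp: perms_def)
    have "card ({0..<n} - J) \<le> 1"
      using J assms(2) by (simp add: card_Diff_subset finite_subset)
    \<comment> \<open>If \<open>J\<close> is all of \<open>{0..<n}\<close>, any \<open>i\<close>
      will do.\<close>
    then obtain i where "{0..<n} - J \<subseteq> {i}"
      by (metis card_1_singletonE card_0_eq finite_Diff finite_atLeastLessThan
          empty_subsetI le_neq_implies_less less_one order_refl)
    then have "\<sigma> = \<tau>"
      using agree by (intro permutes_eqI_off_one[OF perm, of i]) auto
    with IJ pq show "p = q" by simp
  qed
  have "subdiagonals n S k = ?g ` (?Js \<times> S)"
    unfolding subdiagonals_def by (auto simp: image_iff)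
  then have "sum f (subdiagonals n S k) = (\<Sum>(J, \<sigma>)\<in>?Js \<times> S. f (?g (J, \<sigma>)))"
    using sum.reindex[OF inj, of f] by (simp add: case_prod_unfold)
  also have "\<dots> = (\<Sum>J\<in>?Js. \<Sum>\<sigma>\<in>S. f (?g (J, \<sigma>)))"
    by (simp add: sum.cartesian_product)
  finally show ?thesis by simp
qed

lemma sum_Pow_by_card:
  fixes f :: "'b set \<Rightarrow> 'a::comm_ring_1"
  assumes "finite S"
  shows "(\<Sum>J\<in>Pow S. (-1) ^ card (S - J) * f J) =
    (\<Sum>k\<le>card S. (-1) ^ (card S - k) * (\<Sum>J | J \<subseteq> S \<and> card J = k. f J))"
proof -
  have "(\<Sum>J\<in>Pow S. (-1) ^ card (S - J) * f J) =
      (\<Sum>k\<le>card S. \<Sum>J | J \<in> Pow S \<and> card J = k. (-1) ^ card (S - J) * f J)"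
    by (rule sum.group[symmetric]) (use assms in \<open>auto intro: card_mono\<close>)
  also have "\<dots> = (\<Sum>k\<le>card S. (-1) ^ (card S - k) * (\<Sum>J | J \<subseteq> S \<and> card J = k. f J))"
    unfolding sum_distrib_left
    by (intro sum.cong) (use assms in \<open>auto simp: card_Diff_subset finite_subset\<close>)
  finally show ?thesis .
qed

section \<open>Expansions of the determinant multiplied by the factorial\<close>

context
  fixes A :: "'a::comm_ring_1 mat" and n :: nat
  assumes A: "A \<in> carrier_mat n n"
begin

text \<open>Common source of all three formulas: \<open>finite_difference_power\<close> with
  \<open>m = n\<close> replaces each product in the Leibniz expansion, and its arbitrary base point
  \<open>c\<close> may vary with \<sigma>.\<close>

lemma fact_mult_det:
  "of_nat (fact n) * det A = (\<Sum>\<sigma>\<in>perms n. signof \<sigma> *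
    (\<Sum>J\<in>Pow {0..<n}. (-1) ^ card ({0..<n} - J) * (\<gamma> \<sigma> + (\<Sum>j\<in>J. A $$ (j, \<sigma> j))) ^ n))"
  unfolding det_def'[OF A] perms_def
  by (simp add: finite_difference_power sum_distrib_left mult_ac)

lemma fact_mult_det_lengths:
  "of_nat (fact n) * det A = (\<Sum>\<sigma>\<in>perms n. (-1) ^ inversions n \<sigma> *
     ((-1) ^ n * \<gamma> \<sigma> ^ n +
      (\<Sum>k = 1..n. (-1) ^ (n - k) *
         (\<Sum>J | J \<subseteq> {0..<n} \<and> card J = k. (\<gamma> \<sigma> + (\<Sum>j\<in>J. A $$ (j, \<sigma> j))) ^ n))))"
proof -
  have sgn: "(-1) ^ inversions n \<sigma> = (signof \<sigma> :: 'a)" if "\<sigma> \<in> perms n" for \<sigma>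
    using arg_cong[OF minus_one_power_inversions, of \<sigma> n of_int] that by (simp add: perms_def)
  \<comment> \<open>Length 0 contributes only the empty set, which yields the separate term
    \<open>(-1) ^ n * \<gamma> \<sigma> ^ n\<close>.\<close>
  have empty: "{J. J \<subseteq> {0..<n} \<and> card J = 0} = {{}}"
    using finite_subset by fastforce
  have "(\<Sum>k\<le>n. F k) = F 0 + (\<Sum>k = 1..n. F k)" for F :: "nat \<Rightarrow> 'a"
    by (simp add: sum.atLeast_Suc_atMost atMost_atLeast0)
  then show ?thesis
    unfolding fact_mult_det[of \<gamma>]
    by (intro sum.cong) (simp_all add: sum_Pow_by_card sgn empty)
qed

text \<open>After exchanging the sums, only the lengths \<open>n\<close> and \<open>n - 1\<close>
  survive, with signs \<open>(-1) ^ 0\<close> and \<open>(-1) ^ 1\<close>. These depend on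
  \<open>n - k\<close> alone, hence the outer factor -1 for every parity of
  \<open>n\<close>.\<close>

lemma fact_mult_det_subdiagonals:
  assumes "n \<ge> 1"
  shows "of_nat (fact n) * det A =
    - ((\<Sum>l\<in>L_even n (n - 1). (\<gamma> + su A l) ^ n) - (\<Sum>l\<in>L_odd n (n - 1). (\<gamma> + su A l) ^ n)
       + (\<Sum>l\<in>L_odd n n. (\<gamma> + su A l) ^ n) - (\<Sum>l\<in>L_even n n. (\<gamma> + su A l) ^ n))"
proof -
  let ?f = "\<lambda>J \<sigma>. (\<gamma> + (\<Sum>j\<in>J. A $$ (j, \<sigma> j))) ^ n"
  let ?d = "\<lambda>J. sum (?f J) (even_perms n) - sum (?f J) (odd_perms n)"
  let ?Js = "\<lambda>k. {J. J \<subseteq> {0..<n} \<and> card J = k}"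
  obtain m where m: "n = Suc m" using assms by (cases n) auto
  \<comment> \<open>At least two indices lie outside such a \<open>J\<close>, and transposing them
    leaves every entry indexed by \<open>J\<close> unchanged.\<close>
  have zero: "?d J = 0" if J: "J \<subseteq> {0..<n}" "card J < m" for J
  proof -
    have "card ({0..<n} - J) > 1"
      using J m by (simp add: card_Diff_subset finite_subset)
    then obtain a b where "a \<in> {0..<n} - J" "b \<in> {0..<n} - J" "a \<noteq> b"
      by (metis card_le_Suc0_iff_eq finite_Diff finite_atLeastLessThan One_nat_def not_less)
    then have "sum (?f J) (even_perms n) = sum (?f J) (odd_perms n)"
      by (intro sum_even_perms_eq_sum_odd_perms[of a n b])
        (auto intro!: arg_cong2[where f = power] sum.cong simp: transpose_def)
    then show ?thesis by simp
  qed
  have L: "(\<Sum>l\<in>L_even n k. (\<gamma> + su A l) ^ n) = (\<Sum>J\<in>?Js k. sum (?f J) (even_perms n))"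
    "(\<Sum>l\<in>L_odd n k. (\<gamma> + su A l) ^ n) = (\<Sum>J\<in>?Js k. sum (?f J) (odd_perms n))"
    if "n \<le> Suc k" for k
    unfolding L_even_def L_odd_def using that
    by (auto simp: sum_subdiagonals even_perms_def odd_perms_def su_graph)
  have "of_nat (fact n) * det A = (\<Sum>\<sigma>\<in>perms n. \<Sum>J\<in>Pow {0..<n}.
      (-1) ^ card ({0..<n} - J) * (signof \<sigma> * ?f J \<sigma>))"
    unfolding fact_mult_det[of "\<lambda>_. \<gamma>"] by (simp add: sum_distrib_left mult_ac)
  also have "\<dots> = (\<Sum>J\<in>Pow {0..<n}. (-1) ^ card ({0..<n} - J) * ?d J)"
    by (subst sum.swap) (simp only: sum_distrib_left[symmetric] sum_signof)
  also have "\<dots> = (\<Sum>k\<le>n. (-1) ^ (n - k) * sum ?d (?Js k))"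
    by (simp add: sum_Pow_by_card)
  also have "\<dots> = sum ?d (?Js n) - sum ?d (?Js m) + (\<Sum>k<m. (-1) ^ (n - k) * sum ?d (?Js k))"
    unfolding m by (simp add: lessThan_Suc_atMost[symmetric])
  also have "(\<Sum>k<m. (-1) ^ (n - k) * sum ?d (?Js k)) = 0"
    by (intro sum.neutral ballI) (simp add: zero)
  finally show ?thesis
    using L[of n] L[of m] m by (simp add: sum_subtractf)
qed

end

theorem theorem1:
  fixes A :: "'a::comm_ring_1 mat" and n :: nat
  assumes "division_by_integers TYPE('a)"
    and "n \<ge> 1"
    and "A \<in> carrier_mat n n"
  shows
    "(\<forall>\<gamma> :: (nat \<Rightarrow> nat) \<Rightarrow> 'a.
        det A = int_quot (fact n)
          (\<Sum>\<sigma>\<in>perms n. (-1) ^ inversions n \<sigma> *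
             ((-1) ^ n * \<gamma> \<sigma> ^ n +
              (\<Sum>k = 1..n. (-1) ^ (n - k) *
                 (\<Sum>J | J \<subseteq> {0..<n} \<and> card J = k. (\<gamma> \<sigma> + (\<Sum>j\<in>J. A $$ (j, \<sigma> j))) ^ n))))) \<and>
     (\<forall>\<gamma> :: 'a.
        det A = - int_quot (fact n)
          ((\<Sum>l\<in>L_even n (n - 1). (\<gamma> + su A l) ^ n) - (\<Sum>l\<in>L_odd n (n - 1). (\<gamma> + su A l) ^ n)
           + (\<Sum>l\<in>L_odd n n. (\<gamma> + su A l) ^ n) - (\<Sum>l\<in>L_even n n. (\<gamma> + su A l) ^ n))) \<and>
     det A = - int_quot (fact n)
       ((\<Sum>l\<in>L_even n (n - 1). su A l ^ n) - (\<Sum>l\<in>L_odd n (n - 1). su A l ^ n)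
        + (\<Sum>l\<in>L_odd n n. su A l ^ n) - (\<Sum>l\<in>L_even n n. su A l ^ n))"
proof -
  let ?B = "\<lambda>\<gamma>. (\<Sum>l\<in>L_even n (n - 1). (\<gamma> + su A l) ^ n) - (\<Sum>l\<in>L_odd n (n - 1). (\<gamma> + su A l) ^ n)
    + (\<Sum>l\<in>L_odd n n. (\<gamma> + su A l) ^ n) - (\<Sum>l\<in>L_even n n. (\<gamma> + su A l) ^ n)"
  have "(of_int (fact n) :: 'a) = of_nat (fact n)"
    by (metis of_int_of_nat_eq of_nat_fact)
  then have quot: "int_quot (fact n) (of_nat (fact n) * x) = x" for x :: 'a
    using int_quot_mult[OF assms(1), of "fact n" x] by simp
  \<comment> \<open>Keeping the minus sign with \<open>det A\<close> lets \<open>quot\<close> apply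
    directly, without additivity of \<open>int_quot\<close>.\<close>
  have "?B \<gamma> = of_nat (fact n) * (- det A)" for \<gamma>
    using fact_mult_det_subdiagonals[OF assms(3,2), of \<gamma>] by simp
  then have B: "det A = - int_quot (fact n) (?B \<gamma>)" for \<gamma>
    by (simp only: quot minus_minus)
  show ?thesis
    using B B[of 0] by (simp only: fact_mult_det_lengths[OF assms(3), symmetric] quot add_0_left) blast
qed

end
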